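(* Let $m,n\ge 2$ and $r\ge 2$ be integers and let $G$ be the $m\times n$ grid. Then \[ \mathcal{D}_r(G,\mathcal{T})\ge \frac{r-1}{4r}\cdot mn+1-2r . \]
   Context: The $m\times n$ grid is the graph with vertex set $\{1,\dots,m\}\times\{1,\dots,n\}$ (so $mn$ vertices) in which two vertices are adjacent if and only if they differ by exactly $1$ in one coordinate and agree in the other. Write $[r]=\{1,\dots,r\}$. $\mathcal{T}$ denotes the set of all trees. For a finite graph $G$ and an integer $r\ge 2$, the $r$-colour discrepancy of trees in $G$ is \[ \mathcal{D}_r(G,\mathcal{T})=\min_{f:E(G)\to[r]}\ \max_{S}\ \max_{j\in[r]}\left(r\left|f^{-1}(j)\cap E(S)\right|-|E(S)|\right), \] where the first maximum is over all (not necessarily induced or spanning) subgraphs $S$ of $G$ that are trees. *)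

theory Defs
  imports Complex_Main "HOL-Library.FuncSet"
begin

datatype 'v graph = Graph (verts: "'v set") (edges: "'v set set")

definition simple_graph :: "'v graph \<Rightarrow> bool" where
  "simple_graph G \<longleftrightarrow> (\<forall>e\<in>edges G. e \<subseteq> verts G \<and> card e = 2)"

definition finite_graph :: "'v graph \<Rightarrow> bool" where
  "finite_graph G \<longleftrightarrow> simple_graph G \<and> finite (verts G)"

definition subgraph :: "'v graph \<Rightarrow> 'v graph \<Rightarrow> bool" where
  "subgraph S G \<longleftrightarrow> simple_graph S \<and> verts S \<subseteq> verts G \<and> edges S \<subseteq> edges G"

definition walk :: "'v graph \<Rightarrow> 'v list \<Rightarrow> bool" where
  "walk G p \<longleftrightarrow> p \<noteq> [] \<and> set p \<subseteq> verts G \<and> successively (\<lambda>u v. {u, v} \<in> edges G) p"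

definition connected_graph :: "'v graph \<Rightarrow> bool" where
  "connected_graph G \<longleftrightarrow> verts G \<noteq> {} \<and>
     (\<forall>u\<in>verts G. \<forall>v\<in>verts G. \<exists>p. walk G p \<and> hd p = u \<and> last p = v)"

text \<open>A cycle is given by the list of its vertices, each occurring once; the closing
  edge joins the last vertex to the first.\<close>

definition cycle :: "'v graph \<Rightarrow> 'v list \<Rightarrow> bool" where
  "cycle G c \<longleftrightarrow> walk G c \<and> distinct c \<and> length c \<ge> 3 \<and> {last c, hd c} \<in> edges G"

definition trees :: "'v graph set" where
  "trees = {T. finite_graph T \<and> connected_graph T \<and> (\<nexists>c. cycle T c)}"

definition tree_subgraphs :: "'v graph \<Rightarrow> 'v graph set" where
  "tree_subgraphs G = {S. subgraph S G \<and> S \<in> trees}"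

text \<open>The colourings are the extensional functions from the edge set to \<open>{1..r}\<close>.  For a
  finite graph with at least one vertex and \<open>r \<ge> 1\<close>, every minimum and maximum below ranges
  over a finite nonempty set (see the lemmas that follow); the values are integers because
  the difference may be negative.\<close>

definition tree_discrepancy :: "nat \<Rightarrow> 'v graph \<Rightarrow> int" where
  "tree_discrepancy r G =
     (MIN f\<in>edges G \<rightarrow>\<^sub>E {1..r}. MAX S\<in>tree_subgraphs G. MAX j\<in>{1..r}.
        int r * int (card (f -` {j} \<inter> edges S)) - int (card (edges S)))"

definition grid_adj :: "nat \<times> nat \<Rightarrow> nat \<times> nat \<Rightarrow> bool" where
  "grid_adj u v \<longleftrightarrow>
     (\<bar>int (fst u) - int (fst v)\<bar> = 1 \<and> snd u = snd v) \<or>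
     (fst u = fst v \<and> \<bar>int (snd u) - int (snd v)\<bar> = 1)"

definition grid :: "nat \<Rightarrow> nat \<Rightarrow> (nat \<times> nat) graph" where
  "grid m n = Graph ({1..m} \<times> {1..n})
     {{u, v} | u v. u \<in> {1..m} \<times> {1..n} \<and> v \<in> {1..m} \<times> {1..n} \<and> grid_adj u v}"

lemma finite_edges:
  assumes "finite_graph G"
  shows "finite (edges G)"
proof (rule finite_subset)
  show "edges G \<subseteq> Pow (verts G)"
    using assms by (auto simp: finite_graph_def simple_graph_def)
  show "finite (Pow (verts G))"
    using assms by (simp add: finite_graph_def)
qed

lemma finite_colourings:
  assumes "finite_graph G"
  shows "finite (edges G \<rightarrow>\<^sub>E {1..r::nat})"
  using finite_edges[OF assms] by (intro finite_PiE) auto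

lemma colourings_nonempty:
  assumes "r \<ge> 1"
  shows "edges G \<rightarrow>\<^sub>E {1..r::nat} \<noteq> {}"
  using assms by (simp add: PiE_eq_empty_iff)

lemma finite_tree_subgraphs:
  assumes "finite_graph G"
  shows "finite (tree_subgraphs G)"
proof (rule finite_subset)
  show "tree_subgraphs G \<subseteq> (\<lambda>(V, E). Graph V E) ` (Pow (verts G) \<times> Pow (edges G))"
  proof
    fix S assume "S \<in> tree_subgraphs G"
    then have "(verts S, edges S) \<in> Pow (verts G) \<times> Pow (edges G)"
      by (auto simp: tree_subgraphs_def subgraph_def)
    then show "S \<in> (\<lambda>(V, E). Graph V E) ` (Pow (verts G) \<times> Pow (edges G))"
      by (rule rev_image_eqI) simp
  qed
  show "finite ((\<lambda>(V, E). Graph V E) ` (Pow (verts G) \<times> Pow (edges G)))"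
    using assms finite_edges[OF assms] by (simp add: finite_graph_def)
qed

lemma singleton_tree_subgraph:
  assumes "v \<in> verts G"
  shows "Graph {v} {} \<in> tree_subgraphs G"
proof -
  have "walk (Graph {v} {}) [v]"
    by (simp add: walk_def)
  then have "\<exists>p. walk (Graph {v} {}) p \<and> hd p = v \<and> last p = v"
    by (intro exI[of _ "[v]"]) simp
  then show ?thesis
    using assms
    by (simp add: tree_subgraphs_def subgraph_def trees_def finite_graph_def
        simple_graph_def connected_graph_def cycle_def)
qed

lemma finite_graph_grid: "finite_graph (grid m n)"
proof -
  have "e \<subseteq> verts (grid m n) \<and> card e = 2" if e: "e \<in> edges (grid m n)" for e
  proof -
    obtain u v where uv: "e = {u, v}" "u \<in> {1..m} \<times> {1..n}" "v \<in> {1..m} \<times> {1..n}" "grid_adj u v"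
      using e unfolding grid_def graph.sel by blast
    have "u \<noteq> v"
      using uv(4) by (auto simp: grid_adj_def)
    then show ?thesis
      using uv(1-3) by (simp add: grid_def)
  qed
  moreover have "finite (verts (grid m n))"
    by (simp add: grid_def)
  ultimately show ?thesis
    by (simp add: finite_graph_def simple_graph_def)
qed

end

theory Submission
  imports Defs
begin

text \<open>A tree with many leaves already forces a large discrepancy.  Let \<open>S\<close> be a tree in \<open>G\<close>
  and let \<open>P\<close> be a set of vertices outside \<open>S\<close>, each joined to \<open>S\<close> by one chosen pendant edge.
  Given a colouring, let \<open>T\<^sub>j\<close> consist of \<open>S\<close> and the pendant edges of colour \<open>j\<close>.  Every
  \<open>T\<^sub>j\<close> is a tree.  In the sum over all \<open>j\<close> of the discrepancies of colour \<open>j\<close> in \<open>T\<^sub>j\<close>, the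
  edges of \<open>S\<close> cancel, because each of them is counted \<open>r\<close> times positively, for its own
  colour, and once negatively for each of the \<open>r\<close> colours.  Each pendant edge occurs in exactly
  one \<open>T\<^sub>j\<close>, where it has the right colour, and so it contributes \<open>r - 1\<close>.  Hence some
  \<open>T\<^sub>j\<close> has discrepancy at least \<open>(r - 1) |P| / r\<close> (lemma \<open>tree_discrepancy_pendant\<close>).

  In the grid, a comb serves as \<open>S\<close>: the line \<open>{1} \<times> [n]\<close> together with all lines
  \<open>[m] \<times> {y}\<close> for odd \<open>y\<close> (lemma \<open>comb_tree\<close>).  The remaining vertices \<open>(x, y)\<close>, with
  \<open>x \<ge> 2\<close> and even \<open>y\<close>, hang from \<open>(x, y - 1)\<close>, and there are
  \<open>(m - 1) \<lfloor>n / 2\<rfloor> \<ge> mn / 4 - 1 / 2\<close> of them.  The loss of \<open>1 / 2\<close> is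
  covered by the term \<open>1 - 2 r\<close>.\<close>

section \<open>Growing trees by pendant vertices\<close>

lemma walk_mono:
  assumes "walk G p" "verts G \<subseteq> verts H" "edges G \<subseteq> edges H"
  shows "walk H p"
  using assms unfolding walk_def by (auto elim: successively_mono)

lemma attach_vertex_connected:
  assumes "connected_graph T" "u \<in> verts T"
  shows "connected_graph (Graph (insert v (verts T)) (insert {v, u} (edges T)))"
    (is "connected_graph ?H")
proof -
  have old: "walk ?H p" if "walk T p" for p
    using that by (rule walk_mono) auto
  have "\<exists>p. walk ?H p \<and> hd p = a \<and> last p = b" if ab: "a \<in> verts ?H" "b \<in> verts ?H" for a b
  proof (cases "a \<in> verts T"; cases "b \<in> verts T")
    assume "a \<in> verts T" "b \<in> verts T"
    then show ?thesis
      using assms(1) old unfolding connected_graph_def by blast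
  next
    assume "a \<in> verts T" "b \<notin> verts T"
    then obtain p where p: "walk T p" "hd p = a" "last p = u"
      using assms unfolding connected_graph_def by blast
    have "walk ?H (p @ [v])"
      using old[OF p(1)] p(3) by (auto simp: walk_def successively_append_iff insert_commute)
    moreover have "hd (p @ [v]) = a" "last (p @ [v]) = b"
      using p \<open>b \<notin> verts T\<close> ab by (auto simp: walk_def)
    ultimately show ?thesis by blast
  next
    assume "a \<notin> verts T" "b \<in> verts T"
    then obtain p where p: "walk T p" "hd p = u" "last p = b"
      using assms unfolding connected_graph_def by blast
    have "walk ?H (v # p)"
      using old[OF p(1)] p(2) by (auto simp: walk_def successively_Cons)
    moreover have "hd (v # p) = a" "last (v # p) = b"
      using p \<open>a \<notin> verts T\<close> ab by (auto simp: walk_def)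
    ultimately show ?thesis by blast
  next
    assume "a \<notin> verts T" "b \<notin> verts T"
    then have "walk ?H [v] \<and> hd [v] = a \<and> last [v] = b"
      using ab by (auto simp: walk_def)
    then show ?thesis by blast
  qed
  then show ?thesis
    by (simp add: connected_graph_def)
qed

text \<open>On a cycle every vertex has two different neighbours, but the new vertex has the single
  neighbour \<open>u\<close>.  So a cycle avoids the new vertex and lies in the old graph.\<close>

lemma attach_vertex_acyclic:
  assumes "simple_graph T" "\<nexists>c. cycle T c" "v \<notin> verts T"
  shows "\<nexists>c. cycle (Graph (insert v (verts T)) (insert {v, u} (edges T))) c"
    (is "\<nexists>c. cycle ?H c")
proof
  assume "\<exists>c. cycle ?H c"
  then obtain c where c: "cycle ?H c" ..
  have nb: "w = u" if "{w, v} \<in> edges ?H \<or> {v, w} \<in> edges ?H" "w \<noteq> v" for w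
    using that assms(1,3) by (auto simp: simple_graph_def doubleton_eq_iff)
  have len: "length c \<ge> 3" and dist: "distinct c" and closing: "{last c, hd c} \<in> edges ?H"
    and succ: "successively (\<lambda>a b. {a, b} \<in> edges ?H) c" and verts: "set c \<subseteq> insert v (verts T)"
    using c by (auto simp: cycle_def walk_def)
  show False
  proof (cases "v \<in> set c")
    case True
    then obtain xs ys where eq: "c = xs @ v # ys"
      by (meson split_list)
    have left: "last xs = u" if "xs \<noteq> []"
    proof (rule nb)
      show "{last xs, v} \<in> edges ?H \<or> {v, last xs} \<in> edges ?H"
        using succ that unfolding eq by (simp add: successively_append_iff)
      show "last xs \<noteq> v"
        using dist that last_in_set[OF that] unfolding eq by auto
    qed
    have right: "hd ys = u" if "ys \<noteq> []"
    proof (rule nb)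
      show "{hd ys, v} \<in> edges ?H \<or> {v, hd ys} \<in> edges ?H"
        using succ that unfolding eq by (simp add: successively_append_iff successively_Cons)
      show "hd ys \<noteq> v"
        using dist that hd_in_set[OF that] unfolding eq by auto
    qed
    \<comment> \<open>The neighbours of \<open>v\<close> on the cycle are the entries beside it, cyclically; the closing
      edge supplies one of them when \<open>v\<close> is the first or the last entry.\<close>
    consider "xs \<noteq> []" "ys \<noteq> []" | "xs = []" | "ys = []" by blast
    then show False
    proof cases
      case 1
      then have "u \<in> set xs \<inter> set ys"
        using left right last_in_set[of xs] hd_in_set[of ys] by simp
      then show False
        using dist eq by auto
    next
      case 2
      with len eq obtain a b zs where ys: "ys = a # b # zs"
        by (cases ys; cases "tl ys") auto
      have "last ys = u"
      proof (rule nb)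
        show "{last ys, v} \<in> edges ?H \<or> {v, last ys} \<in> edges ?H"
          using closing 2 unfolding eq ys by simp
        show "last ys \<noteq> v"
          using dist last_in_set[of ys] unfolding eq ys by auto
      qed
      moreover have "a = u"
        using right ys by simp
      moreover have "last ys \<in> set (b # zs)"
        unfolding ys by auto
      ultimately show False
        using dist eq ys by auto
    next
      case 3
      with len eq obtain a b zs where xs: "xs = a # b # zs"
        by (cases xs; cases "tl xs") auto
      have "a = u"
      proof (rule nb)
        show "{a, v} \<in> edges ?H \<or> {v, a} \<in> edges ?H"
          using closing 3 unfolding eq xs by simp
        show "a \<noteq> v"
          using dist unfolding eq xs by auto
      qed
      moreover have "last xs = u"
        using left xs by simp
      moreover have "last xs \<in> set (b # zs)"
        unfolding xs by auto
      ultimately show False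
        using dist eq xs by auto
    qed
  next
    case False
    have old: "{a, b} \<in> edges T" if "{a, b} \<in> edges ?H" "a \<in> set c" "b \<in> set c" for a b
      using that False by (auto simp: doubleton_eq_iff)
    have "c \<noteq> []"
      using len by auto
    then have "{last c, hd c} \<in> edges T"
      using closing by (intro old) auto
    moreover have "successively (\<lambda>a b. {a, b} \<in> edges T) c"
      using succ by (rule successively_mono) (use old in blast)
    ultimately have "cycle T c"
      using len dist verts False \<open>c \<noteq> []\<close> by (auto simp: cycle_def walk_def)
    then show False
      using assms(2) by blast
  qed
qed

lemma attach_vertex_tree:
  assumes "T \<in> trees" "u \<in> verts T" "v \<notin> verts T"
  shows "Graph (insert v (verts T)) (insert {v, u} (edges T)) \<in> trees"
proof -
  have "u \<noteq> v"
    using assms by auto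
  then have "finite_graph (Graph (insert v (verts T)) (insert {v, u} (edges T)))"
    using assms by (auto simp: trees_def finite_graph_def simple_graph_def)
  moreover have "connected_graph (Graph (insert v (verts T)) (insert {v, u} (edges T)))"
    using assms by (intro attach_vertex_connected) (auto simp: trees_def)
  moreover have "\<nexists>c. cycle (Graph (insert v (verts T)) (insert {v, u} (edges T))) c"
    using assms by (intro attach_vertex_acyclic) (auto simp: trees_def finite_graph_def)
  ultimately show ?thesis
    by (simp add: trees_def)
qed

lemma attach_pendant_set_tree:
  assumes "T \<in> trees" "finite P" "P \<inter> verts T = {}" "\<And>v. v \<in> P \<Longrightarrow> p v \<in> verts T"
  shows "Graph (verts T \<union> P) (edges T \<union> (\<lambda>v. {v, p v}) ` P) \<in> trees"
  using assms(2-4)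
proof (induction P rule: finite_induct)
  case empty
  then show ?case
    using assms(1) by simp
next
  case (insert v P)
  then show ?case
    using attach_vertex_tree[of "Graph (verts T \<union> P) (edges T \<union> (\<lambda>v. {v, p v}) ` P)" "p v" v]
    by auto
qed

text \<open>A parent function that decreases a height \<open>h\<close> describes a rooted tree: adding the
  vertices by increasing height adds each of them as a pendant vertex, its parent being already
  present.\<close>

lemma parent_function_tree:
  fixes p :: "'v \<Rightarrow> 'v" and h :: "'v \<Rightarrow> nat"
  assumes "finite V" "\<rho> \<notin> V"
    and "\<And>v. v \<in> V \<Longrightarrow> p v \<in> insert \<rho> V"
    and "\<And>v. v \<in> V \<Longrightarrow> h (p v) < h v"
  shows "Graph (insert \<rho> V) ((\<lambda>v. {v, p v}) ` V) \<in> trees"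
  using assms
proof (induction V rule: finite_ranking_induct[where f = h])
  case empty
  then show ?case
    using singleton_tree_subgraph[of \<rho> "Graph {\<rho>} {}"] by (simp add: tree_subgraphs_def)
next
  case (insert v V)
  show ?case
  proof (cases "v \<in> V")
    case True
    then show ?thesis
      using insert by (simp add: insert_absorb)
  next
    case False
    \<comment> \<open>The parent of \<open>w \<in> V\<close> is lower than \<open>w\<close>, and \<open>v\<close> is at least as high.\<close>
    have "p w \<in> insert \<rho> V" if "w \<in> V" for w
      using insert.hyps(2)[OF that] insert.prems(2)[of w] insert.prems(3)[of w] that by fastforce
    then have IH: "Graph (insert \<rho> V) ((\<lambda>v. {v, p v}) ` V) \<in> trees"
      using insert by simp
    have "p v \<in> insert \<rho> V"
      using insert.prems(2)[of v] insert.prems(3)[of v] by auto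
    then show ?thesis
      using attach_vertex_tree[OF IH, of "p v" v] False insert.prems(1)
      by (auto simp: insert_commute[of v \<rho>])
  qed
qed

section \<open>Averaging over the colours\<close>

lemma sum_card_colour_classes:
  assumes "finite A" "f ` A \<subseteq> {1..r}"
  shows "(\<Sum>j\<in>{1..r::nat}. card {a \<in> A. f a = j}) = card A"
  using sum.group[OF assms(1) _ assms(2), of "\<lambda>_. 1::nat"] by simp

text \<open>For an optimal colouring, each tree \<open>T j\<close>, formed by \<open>S\<close> and the pendant edges of colour
  \<open>j\<close>, has discrepancy at most \<open>tree_discrepancy r G\<close> in colour \<open>j\<close>.  Adding these \<open>r\<close>
  inequalities removes the unknown distribution of colours inside \<open>S\<close>.\<close>

lemma tree_discrepancy_pendant:
  assumes G: "finite_graph G" and S: "S \<in> tree_subgraphs G" and r: "r \<ge> 1"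
    and P: "P \<subseteq> verts G" "P \<inter> verts S = {}"
    and p: "\<And>v. v \<in> P \<Longrightarrow> p v \<in> verts S" "\<And>v. v \<in> P \<Longrightarrow> {v, p v} \<in> edges G"
  shows "(int r - 1) * int (card P) \<le> int r * tree_discrepancy r G"
proof -
  define val where "val f S j = int r * int (card (f -` {j} \<inter> edges S)) - int (card (edges S))"
    for f :: "'a set \<Rightarrow> nat" and S j
  define F where "F f = (MAX S\<in>tree_subgraphs G. MAX j\<in>{1..r}. val f S j)" for f
  have "tree_discrepancy r G \<in> F ` (edges G \<rightarrow>\<^sub>E {1..r})"
    unfolding tree_discrepancy_def F_def val_def
    by (intro Min_in finite_imageI finite_colourings[OF G])
      (use colourings_nonempty[OF r, of G] in blast)
  then obtain f where f: "f \<in> edges G \<rightarrow>\<^sub>E {1..r}" and D: "tree_discrepancy r G = F f"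
    by blast
  have val_le: "val f T j \<le> tree_discrepancy r G" if "T \<in> tree_subgraphs G" "j \<in> {1..r}" for T j
  proof -
    have "val f T j \<le> (MAX j\<in>{1..r}. val f T j)"
      using that by (intro Max_ge) auto
    also have "\<dots> \<le> F f"
      unfolding F_def using that by (intro Max_ge finite_imageI finite_tree_subgraphs[OF G]) auto
    finally show ?thesis
      using D by simp
  qed
  have S_tree: "S \<in> trees" and S_sub: "subgraph S G"
    using S by (auto simp: tree_subgraphs_def)
  have fin: "finite P" "finite (edges S)"
    using finite_subset[OF P(1)] G S_tree finite_edges
    by (auto simp: finite_graph_def trees_def)
  define pend where "pend v = {v, p v}" for v
  define Q where "Q j = {v \<in> P. f (pend v) = j}" for j
  define T where "T j = Graph (verts S \<union> Q j) (edges S \<union> pend ` Q j)" for j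
  have T_tree: "T j \<in> tree_subgraphs G" for j
  proof -
    have "T j \<in> trees"
      unfolding T_def pend_def using S_tree fin P p
      by (intro attach_pendant_set_tree) (auto simp: Q_def)
    then show ?thesis
      using S_sub P p
      by (auto simp: tree_subgraphs_def subgraph_def trees_def finite_graph_def T_def Q_def pend_def)
  qed
  have inj: "inj_on pend P"
    using P p by (auto simp: inj_on_def pend_def doubleton_eq_iff)
  have new: "edges S \<inter> pend ` P = {}"
    using S_sub P(2) unfolding subgraph_def simple_graph_def pend_def by blast
  define s where "s j = card {e \<in> edges S. f e = j}" for j
  have val_T: "val f (T j) j = int r * int (s j) - int (card (edges S)) + (int r - 1) * int (card (Q j))"
    for j
  proof -
    have Qj: "card (pend ` Q j) = card (Q j)"
      by (rule card_image) (use inj in \<open>auto simp: Q_def inj_on_def\<close>)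
    have finQ: "finite (pend ` Q j)"
      using fin by (simp add: Q_def)
    have "card (edges (T j)) = card (edges S) + card (Q j)"
      unfolding T_def graph.sel Qj[symmetric] using fin finQ new
      by (intro card_Un_disjoint) (auto simp: Q_def)
    moreover have "f -` {j} \<inter> edges (T j) = {e \<in> edges S. f e = j} \<union> pend ` Q j"
      by (auto simp: T_def Q_def)
    moreover have "card ({e \<in> edges S. f e = j} \<union> pend ` Q j) = s j + card (Q j)"
      unfolding s_def Qj[symmetric] using fin finQ new
      by (intro card_Un_disjoint) (auto simp: Q_def)
    ultimately show ?thesis
      by (simp add: val_def algebra_simps)
  qed
  have sum_s: "(\<Sum>j\<in>{1..r}. s j) = card (edges S)"
    unfolding s_def using fin f S_sub
    by (intro sum_card_colour_classes) (auto simp: subgraph_def PiE_iff)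
  have sum_Q: "(\<Sum>j\<in>{1..r}. card (Q j)) = card P"
    unfolding Q_def using fin f p
    by (intro sum_card_colour_classes[where f = "f \<circ> pend", unfolded comp_def])
      (auto simp: pend_def PiE_iff)
  have "(\<Sum>j\<in>{1..r}. val f (T j) j)
      = int r * int (\<Sum>j\<in>{1..r}. s j) - int r * int (card (edges S))
        + (int r - 1) * int (\<Sum>j\<in>{1..r}. card (Q j))"
    by (simp add: val_T sum.distrib sum_subtractf sum_distrib_left)
  also have "\<dots> = (int r - 1) * int (card P)"
    unfolding sum_s sum_Q by simp
  finally have "(int r - 1) * int (card P) = (\<Sum>j\<in>{1..r}. val f (T j) j)" ..
  also have "\<dots> \<le> (\<Sum>j\<in>{1..r}. tree_discrepancy r G)"
    by (intro sum_mono val_le T_tree)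
  finally show ?thesis
    by simp
qed

section \<open>The comb in the grid\<close>

lemma edge_grid:
  assumes "u \<in> {1..m} \<times> {1..n}" "v \<in> {1..m} \<times> {1..n}" "grid_adj u v"
  shows "{u, v} \<in> edges (grid m n)"
  using assms unfolding grid_def graph.sel by blast

definition comb_verts :: "nat \<Rightarrow> nat \<Rightarrow> (nat \<times> nat) set" where
  "comb_verts m n = {(x, y) \<in> {1..m} \<times> {1..n}. x = 1 \<or> odd y}"

definition comb_parent :: "nat \<times> nat \<Rightarrow> nat \<times> nat" where
  "comb_parent = (\<lambda>(x, y). if x = 1 then (1, y - 1) else (x - 1, y))"

lemma comb_tree:
  assumes "m \<ge> 1" "n \<ge> 1"
  obtains S where "S \<in> tree_subgraphs (grid m n)" "verts S = comb_verts m n"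
proof
  let ?V = "comb_verts m n - {(1, 1)}"
  let ?S = "Graph (insert (1, 1) ?V) ((\<lambda>v. {v, comb_parent v}) ` ?V)"
  have sub: "comb_verts m n \<subseteq> {1..m} \<times> {1..n}"
    by (auto simp: comb_verts_def)
  have root: "(1, 1) \<in> comb_verts m n"
    using assms by (simp add: comb_verts_def)
  show "verts ?S = comb_verts m n"
    using root by auto
  have parent: "comb_parent v \<in> comb_verts m n" "grid_adj v (comb_parent v)"
    "fst (comb_parent v) + snd (comb_parent v) < fst v + snd v" if "v \<in> ?V" for v
    using that by (auto simp: comb_verts_def comb_parent_def grid_adj_def split: prod.splits)
  have "?S \<in> trees"
  proof (rule parent_function_tree[where h = "\<lambda>v. fst v + snd v"])
    show "finite ?V"
      using finite_subset[OF sub] by simp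
  qed (use parent in auto)
  moreover have "subgraph ?S (grid m n)"
    unfolding subgraph_def
  proof (intro conjI)
    show "simple_graph ?S"
      using \<open>?S \<in> trees\<close> by (simp add: trees_def finite_graph_def)
    show "verts ?S \<subseteq> verts (grid m n)"
      using sub assms by (auto simp: grid_def)
    show "edges ?S \<subseteq> edges (grid m n)"
      using parent(1,2) sub unfolding graph.sel(2)[of "insert (1, 1) ?V"]
      by (blast intro: edge_grid)
  qed
  ultimately show "?S \<in> tree_subgraphs (grid m n)"
    by (simp add: tree_subgraphs_def)
qed

lemma card_even_upto: "card {y \<in> {1..n}. even y} = n div 2"
proof -
  have "{y \<in> {1..n}. even y} = (\<lambda>k. 2 * k) ` {1..n div 2}"
    by (auto elim!: evenE)
  then show ?thesis
    by (simp add: card_image inj_on_def)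
qed

lemma grid_tree_discrepancy:
  assumes "m \<ge> 1" "n \<ge> 1" "r \<ge> 1"
  shows "(int r - 1) * int ((m - 1) * (n div 2)) \<le> int r * tree_discrepancy r (grid m n)"
proof -
  define P where "P = {2..m} \<times> {y \<in> {1..n}. even y}"
  obtain S where S: "S \<in> tree_subgraphs (grid m n)" "verts S = comb_verts m n"
    using comb_tree assms by blast
  have down: "(fst v, snd v - 1) \<in> comb_verts m n" "{v, (fst v, snd v - 1)} \<in> edges (grid m n)"
    if "v \<in> P" for v
  proof -
    have bounds: "fst v \<in> {2..m}" "snd v \<in> {2..n}" "even (snd v)"
      using that by (auto simp: P_def elim!: evenE)
    then show "(fst v, snd v - 1) \<in> comb_verts m n"
      by (auto simp: comb_verts_def)
    show "{v, (fst v, snd v - 1)} \<in> edges (grid m n)"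
      by (rule edge_grid) (use bounds in \<open>auto simp: grid_adj_def mem_Times_iff\<close>)
  qed
  have "(int r - 1) * int (card P) \<le> int r * tree_discrepancy r (grid m n)"
    by (rule tree_discrepancy_pendant[OF finite_graph_grid S(1) assms(3),
          where p = "\<lambda>v. (fst v, snd v - 1)"])
      (use down S(2) in \<open>auto simp: P_def grid_def comb_verts_def\<close>)
  moreover have "card P = (m - 1) * (n div 2)"
    unfolding P_def card_cartesian_product card_even_upto by simp
  ultimately show ?thesis
    by simp
qed

text \<open>With \<open>\<lfloor>n / 2\<rfloor> \<ge> (n - 1) / 2\<close>, this follows from
  \<open>(m - 1) (n - 1) / 2 - mn / 4 = (m - 2) (n - 2) / 4 - 1 / 2\<close>.\<close>

lemma comb_pendants_lower_bound:
  assumes "m \<ge> 2" "n \<ge> 2"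
  shows "real m * real n / 4 - 1 / 2 \<le> real ((m - 1) * (n div 2))"
proof -
  have "(real m - 2) * (real n - 2) \<ge> 0"
    using assms by simp
  then have "real m * real n / 4 - 1 / 2 \<le> (real m - 1) * ((real n - 1) / 2)"
    by (simp add: field_simps)
  also have "\<dots> \<le> (real m - 1) * real (n div 2)"
  proof (rule mult_left_mono)
    show "(real n - 1) / 2 \<le> real (n div 2)"
    proof -
      have "n \<le> 2 * (n div 2) + 1"
        by linarith
      then have "real n \<le> real (2 * (n div 2) + 1)"
        by (rule of_nat_mono)
      then show ?thesis
        by simp
    qed
  qed (use assms in simp)
  also have "\<dots> = real ((m - 1) * (n div 2))"
    using assms by (simp add: of_nat_diff)
  finally show ?thesis .
qed

theorem corollary2:
  fixes m n r :: nat
  assumes "m \<ge> 2" and "n \<ge> 2" and "r \<ge> 2"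
  shows "real_of_int (tree_discrepancy r (grid m n))
           \<ge> (real r - 1) / (4 * real r) * (real m * real n) + 1 - 2 * real r"
proof -
  let ?D = "real_of_int (tree_discrepancy r (grid m n))"
  have "(int r - 1) * int ((m - 1) * (n div 2)) \<le> int r * tree_discrepancy r (grid m n)"
    using assms by (intro grid_tree_discrepancy) auto
  then have "real_of_int ((int r - 1) * int ((m - 1) * (n div 2)))
      \<le> real_of_int (int r * tree_discrepancy r (grid m n))"
    by (simp only: of_int_le_iff)
  then have D: "(real r - 1) * real ((m - 1) * (n div 2)) \<le> real r * ?D"
    by simp
  have "(real r - 1) * (real m * real n / 4 - 1 / 2) \<le> (real r - 1) * real ((m - 1) * (n div 2))"
    by (rule mult_left_mono[OF comb_pendants_lower_bound]) (use assms in auto)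
  with D have "(real r - 1) * (real m * real n / 4 - 1 / 2) \<le> real r * ?D"
    by linarith
  then have "(real r - 1) * (real m * real n / 4 - 1 / 2) / real r \<le> ?D"
    using assms by (simp add: pos_divide_le_eq mult.commute)
  moreover have "(real r - 1) * (real m * real n / 4 - 1 / 2) / real r
      = (real r - 1) / (4 * real r) * (real m * real n) - (real r - 1) / (2 * real r)"
    using assms by (simp add: field_simps)
  moreover have "(real r - 1) / (2 * real r) \<le> 2 * real r - 1"
  proof -
    have "(real r - 1) / (2 * real r) \<le> 1"
      using assms by (simp add: field_simps)
    then show ?thesis
      using assms by linarith
  qed
  ultimately show ?thesis
    by linarith
qed

end
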